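(* Under Assumption 1, let $\lambda^0\in\mathbb D$, let $\{(z^k,\lambda^k)\}_{k\ge0}$ be generated by Algorithm (DG), and let $\bar\kappa>0$ be a constant such that $\|\lambda-[\lambda]^W_{\Lambda^*}\|_W\le\bar\kappa\,\|\nabla^+d(\lambda)\|_W$ for all $\lambda\in\mathbb D$ with $\mathcal T(\lambda)\le\mathcal T(\lambda^0)$. Set $\rho=\frac{4(1+\bar\kappa)}{1+4(1+\bar\kappa)}$. Then for all $k\ge0$, \[ f^*-d(\lambda^{k+1})\le\tfrac12\,\rho^{\,k-1}\,\mathcal R(\lambda^0)^2 . \]
   Context: Standing setup. Consider $\min_{z}\ f(z)=\sum_{i=1}^M f_i(z_i)$ subject to $Az=b$, $Cz\le c$, where $z=(z_1,\dots,z_M)$, $z_i\in\mathbb{R}^{n_i}$, $n=\sum_i n_i$, $A\in\mathbb{R}^{p\times n}$, $C\in\mathbb{R}^{q\times n}$, $b\in\mathbb{R}^p$, $c\in\mathbb{R}^q$, and each $f_i:\mathbb{R}^{n_i}\to\mathbb{R}$ is convex. The rows are partitioned into $\bar M$ blocks: $A$ has blocks $A_{ji}\in\mathbb{R}^{p_j\times n_i}$ and $C$ has blocks $C_{ji}\in\mathbb{R}^{q_j\times n_i}$. A matrix $E\in\{0,1\}^{\bar M\times M}$ is given such that $E_{ji}=0$ implies $A_{ji}=0$ and $C_{ji}=0$; $\bar{\mathcal N}_i=\{j: E_{ji}\neq 0\}$, $\mathcal N_j=\{i:E_{ji}\ne 0\}$. Let $G=\begin{bmatrix}A\\ C\end{bmatrix}$,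 $g=\begin{bmatrix}b\\ c\end{bmatrix}$, $\lambda=(\nu,\mu)$, $\mathbb{D}=\mathbb{R}^p\times\mathbb{R}^q_+$, $\mathcal L(z,\lambda)=f(z)+\langle\lambda,Gz-g\rangle$, $d(\lambda)=\min_{z}\mathcal L(z,\lambda)$, $\nabla d(\lambda)=Gz(\lambda)-g$ with $z(\lambda)$ the unique minimizer of $\mathcal L(\cdot,\lambda)$. $L_{d_i}=\big\|\begin{bmatrix}[A_{ji}]_{j\in\bar{\mathcal N}_i}\\ [C_{ji}]_{j\in\bar{\mathcal N}_i}\end{bmatrix}\big\|^2/\sigma_i$; $W=\mathrm{diag}(W_\nu,W_\mu)$, $W_\nu=\mathrm{diag}\big(\sum_{i\in\mathcal N_j}L_{d_i}I_{p_j};\ j\big)$, $W_\mu=\mathrm{diag}\big(\sum_{i\in\mathcal N_j}L_{d_i}I_{q_j};\ j\big)$, assumed positive definite; $\|x\|_W=\sqrt{x^TWx}$. Assumption 1: (a) each $f_i$ is $\sigma_i$-strongly convex and has $L_i$-Lipschitz gradient; (b) $A$ has full row rank and there is $\tilde z$ with $A\tilde z=b$, $C\tilde z<c$. Then the set $\Lambda^*$ of maximizers of $d$ over $\mathbb D$ is nonempty and bounded, and $\max_{\mathbb D}d=f^*$, the primal optimal value. $[x]^W_S$ is the $\|\cdot\|_W$-projection onto a closed convex set $S$; $[x]_{\mathbb D}$ is the Euclidean projection onto $\mathbb D$ (equal to $[x]^W_{\mathbb D}$ since $W$ is diagonal). Proximal residual: $\nabla^+ d(\lambda)=[\lambda+W^{-1}\nabla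 d(\lambda)]^W_{\mathbb D}-\lambda$. $\mathcal R(\lambda)=\min_{\lambda^*\in\Lambda^*}\|\lambda^*-\lambda\|_W$, $\mathcal T(\lambda)=\max_{\lambda^*\in\Lambda^*}\|\lambda-\lambda^*\|_W$. Algorithm (DG): given $\lambda^0\in\mathbb D$, for $k\ge0$ set $z^k=\arg\min_{z}\mathcal L(z,\lambda^k)$ and $\lambda^{k+1}=[\lambda^k+W^{-1}\nabla d(\lambda^k)]_{\mathbb D}$. *)

theory Defs
  imports "HOL-Analysis.Analysis"
begin

text \<open>Conventions.  Primal variable z :: real^'n (coordinates 'n); the coordinates are
  partitioned into the M blocks z_i by blk :: 'n => 'm.  The constraint rows of
  G = [A; C] are indexed by a single finite type 'r; isEq r says that row r is a row of A
  (equality constraint), otherwise a row of C (inequality constraint).  The rows are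
  partitioned into the Mbar row blocks by rblk :: 'r => 'mb.  E :: 'mb => 'm => bool is the
  0/1 matrix E (E j i = True iff E_ji = 1).  Dual variables lambda = (nu, mu) :: real^'r.\<close>

definition blkproj :: "('n \<Rightarrow> 'm) \<Rightarrow> 'm \<Rightarrow> real^'n \<Rightarrow> real^'n" where
  "blkproj blk i x = (\<chi> j. if blk j = i then x$j else 0)"

text \<open>F, a function of z that depends only on the block z_i, is sigma-strongly convex
  as a function of z_i.\<close>
definition strongly_convex_blk ::
  "('n \<Rightarrow> 'm) \<Rightarrow> 'm \<Rightarrow> real \<Rightarrow> (real^'n \<Rightarrow> real) \<Rightarrow> bool" where
  "strongly_convex_blk blk i \<sigma> F \<longleftrightarrow>
     (\<forall>x y t. 0 \<le> t \<and> t \<le> 1 \<longrightarrow>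
        F (t *\<^sub>R x + (1 - t) *\<^sub>R y) \<le> t * F x + (1 - t) * F y
          - \<sigma> / 2 * t * (1 - t) * (norm (blkproj blk i (x - y)))\<^sup>2)"

text \<open>F, depending only on z_i, has an L-Lipschitz gradient as a function of z_i.\<close>
definition lipschitz_grad_blk ::
  "('n \<Rightarrow> 'm) \<Rightarrow> 'm \<Rightarrow> real \<Rightarrow> (real^'n \<Rightarrow> real) \<Rightarrow> bool" where
  "lipschitz_grad_blk blk i L F \<longleftrightarrow>
     (\<exists>gr. (\<forall>x. (F has_derivative (\<lambda>h. gr x \<bullet> h)) (at x)) \<and>
           (\<forall>x y. norm (gr x - gr y) \<le> L * norm (blkproj blk i (x - y))))"

definition depends_only_on_blk :: "('n \<Rightarrow> 'm) \<Rightarrow> 'm \<Rightarrow> (real^'n \<Rightarrow> real) \<Rightarrow> bool" where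
  "depends_only_on_blk blk i F \<longleftrightarrow>
     (\<forall>x y. (\<forall>j. blk j = i \<longrightarrow> x$j = y$j) \<longrightarrow> F x = F y)"

text \<open>A has full row rank: the rows of A (rows r of G with isEq r) are linearly independent.\<close>
definition full_row_rank_eq :: "('r \<Rightarrow> bool) \<Rightarrow> real^'n^'r \<Rightarrow> bool" where
  "full_row_rank_eq isEq G \<longleftrightarrow>
     (\<forall>\<nu>::real^'r. (\<forall>r. \<not> isEq r \<longrightarrow> \<nu>$r = 0) \<longrightarrow> transpose G *v \<nu> = 0 \<longrightarrow> \<nu> = 0)"

definition feasible :: "('r \<Rightarrow> bool) \<Rightarrow> real^'n^'r \<Rightarrow> real^'r \<Rightarrow> real^'n \<Rightarrow> bool" where
  "feasible isEq G g z \<longleftrightarrow>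
     (\<forall>r. if isEq r then (G *v z)$r = g$r else (G *v z)$r \<le> g$r)"

definition slater :: "('r \<Rightarrow> bool) \<Rightarrow> real^'n^'r \<Rightarrow> real^'r \<Rightarrow> bool" where
  "slater isEq G g \<longleftrightarrow>
     (\<exists>z. \<forall>r. if isEq r then (G *v z)$r = g$r else (G *v z)$r < g$r)"

text \<open>Primal optimal value f^*.\<close>
definition primal_opt ::
  "(real^'n \<Rightarrow> real) \<Rightarrow> ('r \<Rightarrow> bool) \<Rightarrow> real^'n^'r \<Rightarrow> real^'r \<Rightarrow> real" where
  "primal_opt f isEq G g = Inf (f ` {z. feasible isEq G g z})"

text \<open>D = R^p x R^q_+.\<close>
definition dual_dom :: "('r \<Rightarrow> bool) \<Rightarrow> (real^'r) set" where
  "dual_dom isEq = {l. \<forall>r. \<not> isEq r \<longrightarrow> 0 \<le> l$r}"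

text \<open>Euclidean projection onto D.\<close>
definition proj_D :: "('r \<Rightarrow> bool) \<Rightarrow> real^'r \<Rightarrow> real^'r" where
  "proj_D isEq x = (\<chi> r. if isEq r then x$r else max 0 (x$r))"

definition Lag ::
  "(real^'n \<Rightarrow> real) \<Rightarrow> real^'n^'r \<Rightarrow> real^'r \<Rightarrow> real^'n \<Rightarrow> real^'r \<Rightarrow> real" where
  "Lag f G g z l = f z + l \<bullet> (G *v z - g)"

definition dualfun :: "(real^'n \<Rightarrow> real) \<Rightarrow> real^'n^'r \<Rightarrow> real^'r \<Rightarrow> real^'r \<Rightarrow> real" where
  "dualfun f G g l = (INF z. Lag f G g z l)"

text \<open>z(lambda): the unique minimizer of L(., lambda).\<close>
definition zmin :: "(real^'n \<Rightarrow> real) \<Rightarrow> real^'n^'r \<Rightarrow> real^'r \<Rightarrow> real^'r \<Rightarrow> real^'n" where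
  "zmin f G g l = (THE z. \<forall>z'. Lag f G g z l \<le> Lag f G g z' l)"

text \<open>grad d(lambda) = G z(lambda) - g.\<close>
definition dual_grad :: "(real^'n \<Rightarrow> real) \<Rightarrow> real^'n^'r \<Rightarrow> real^'r \<Rightarrow> real^'r \<Rightarrow> real^'r" where
  "dual_grad f G g l = G *v zmin f G g l - g"

text \<open>The diagonal weights: L_{d_i} and the diagonal entries of W.\<close>
definition Ld ::
  "real^'n^'r \<Rightarrow> ('n \<Rightarrow> 'm) \<Rightarrow> ('r \<Rightarrow> 'mb) \<Rightarrow> ('mb \<Rightarrow> 'm \<Rightarrow> bool) \<Rightarrow> ('m \<Rightarrow> real)
     \<Rightarrow> 'm \<Rightarrow> real" where
  "Ld G blk rblk E \<sigma> i =
     (onorm ((*v) (\<chi> r c. if E (rblk r) i \<and> blk c = i then G$r$c else 0)))\<^sup>2 / \<sigma> i"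

definition Wdiag ::
  "real^'n^'r \<Rightarrow> ('n \<Rightarrow> 'm::finite) \<Rightarrow> ('r \<Rightarrow> 'mb) \<Rightarrow> ('mb \<Rightarrow> 'm \<Rightarrow> bool) \<Rightarrow> ('m \<Rightarrow> real)
     \<Rightarrow> 'r \<Rightarrow> real" where
  "Wdiag G blk rblk E \<sigma> r = (\<Sum>i\<in>{i. E (rblk r) i}. Ld G blk rblk E \<sigma> i)"

definition wnorm :: "('r::finite \<Rightarrow> real) \<Rightarrow> real^'r \<Rightarrow> real" where
  "wnorm Wd x = sqrt (\<Sum>r\<in>UNIV. Wd r * (x$r)\<^sup>2)"

text \<open>Proximal residual grad^+ d(lambda) = [lambda + W^{-1} grad d(lambda)]_D - lambda.\<close>
definition prox_res ::
  "(real^'n \<Rightarrow> real) \<Rightarrow> real^'n^'r \<Rightarrow> real^'r \<Rightarrow> ('r \<Rightarrow> real) \<Rightarrow> ('r \<Rightarrow> bool)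
     \<Rightarrow> real^'r \<Rightarrow> real^'r" where
  "prox_res f G g Wd isEq l =
     proj_D isEq (l + (\<chi> r. (dual_grad f G g l)$r / Wd r)) - l"

text \<open>Lambda^*: the set of maximizers of d over D.\<close>
definition dual_opt_set ::
  "(real^'n \<Rightarrow> real) \<Rightarrow> real^'n^'r \<Rightarrow> real^'r \<Rightarrow> ('r \<Rightarrow> bool) \<Rightarrow> (real^'r) set" where
  "dual_opt_set f G g isEq =
     {l\<in>dual_dom isEq. \<forall>\<mu>\<in>dual_dom isEq. dualfun f G g \<mu> \<le> dualfun f G g l}"

text \<open>W-norm projection onto a set S.\<close>
definition wproj :: "('r::finite \<Rightarrow> real) \<Rightarrow> (real^'r) set \<Rightarrow> real^'r \<Rightarrow> real^'r" where
  "wproj Wd S x = (SOME y. y \<in> S \<and> (\<forall>y'\<in>S. wnorm Wd (x - y) \<le> wnorm Wd (x - y')))"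

definition Rdist :: "('r::finite \<Rightarrow> real) \<Rightarrow> (real^'r) set \<Rightarrow> real^'r \<Rightarrow> real" where
  "Rdist Wd S l = Inf ((\<lambda>\<mu>. wnorm Wd (\<mu> - l)) ` S)"

definition Tdist :: "('r::finite \<Rightarrow> real) \<Rightarrow> (real^'r) set \<Rightarrow> real^'r \<Rightarrow> real" where
  "Tdist Wd S l = Sup ((\<lambda>\<mu>. wnorm Wd (l - \<mu>)) ` S)"

end

theory Submission
  imports Defs
begin

text \<open>Linear convergence of the dual gradient method under an error bound.

  All distances are measured in the W-norm, which we realize as the Euclidean norm of a
  coordinatewise rescaling so that the inner-product geometry of the library applies.
  The argument has three ingredients, developed as general lemmas first.
  (1) Convex duality: strong convexity of the blocks f_i makes every Lagrangian grow
      quadratically around its unique minimizer, so z^k = z(lambda^k) and d(lambda^k) is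
      the Lagrangian at z^k; a separating hyperplane argument with Slater's condition and
      full row rank of A gives strong duality, so Lambda^* is nonempty and closed and d = f^*
      on it.
  (2) Smoothness: the block sparsity E and the constants L_{d_i} yield, via Young's
      inequality block by block, the W-descent lemma for d; combined with the variational
      inequality of the projection onto D it gives the three-point inequality of the step.
  (3) Convergence: the three-point inequality gives ascent, Fejer monotonicity (hence all
      iterates satisfy the hypothesis of the error bound), and with the error bound a
      Q-linear contraction of the gap f^* - d(lambda^k) by 2 kappa / (1 + 2 kappa), which is
      at most rho; the first gap is at most R(lambda^0)^2 / 2.\<close>

section \<open>Weighted norms\<close>

text \<open>The W-norm of a vector is the Euclidean norm of the vector rescaled coordinatewise by
  the square roots of the weights; this lets us use the inner-product geometry of the library.\<close>
definition wscale :: "('r::finite \<Rightarrow> real) \<Rightarrow> real^'r \<Rightarrow> real^'r" where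
  "wscale W x = (\<chi> r. sqrt (W r) * x$r)"

lemma inner_wscale:
  assumes "\<And>r. 0 \<le> W r"
  shows "wscale W x \<bullet> wscale W y = (\<Sum>r\<in>UNIV. W r * x$r * y$r)"
  unfolding wscale_def inner_vec_def
  by (rule sum.cong) (use assms in \<open>auto simp: algebra_simps real_sqrt_mult[symmetric]\<close>)

lemma wnorm_wscale:
  assumes "\<And>r. 0 \<le> W r"
  shows "wnorm W x = norm (wscale W x)"
proof -
  have "(norm (wscale W x))\<^sup>2 = wscale W x \<bullet> wscale W x"
    by (simp add: power2_norm_eq_inner)
  also have "\<dots> = (\<Sum>r\<in>UNIV. W r * (x$r)\<^sup>2)"
    using inner_wscale[of W x x, OF assms] by (simp add: power2_eq_square mult.assoc)
  finally have "(norm (wscale W x))\<^sup>2 = (\<Sum>r\<in>UNIV. W r * (x$r)\<^sup>2)" .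
  then show ?thesis
    unfolding wnorm_def by (metis norm_ge_zero real_sqrt_abs abs_of_nonneg)
qed

lemma linear_wscale: "linear (wscale W)"
  by (rule linearI) (auto simp: wscale_def vec_eq_iff algebra_simps)

lemma wscale_diff: "wscale W (x - y) = wscale W x - wscale W y"
  by (rule linear_diff[OF linear_wscale])

lemma inj_wscale: "(\<And>r. 0 < W r) \<Longrightarrow> inj (wscale W)"
  by (rule injI) (auto simp: wscale_def vec_eq_iff, metis less_irrefl)

section \<open>Elementary facts about real numbers\<close>

text \<open>An affine function of s that stays bounded above on the half-line s \<ge> 0 has a
  nonpositive slope.\<close>
lemma bounded_ray_slope_nonpos:
  fixes a b c :: real
  assumes "\<And>s. 0 \<le> s \<Longrightarrow> c + s * a \<le> b"
  shows "a \<le> 0"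
proof (rule ccontr)
  assume "\<not> a \<le> 0"
  then have a: "a > 0" by simp
  have "c + ((\<bar>b - c\<bar> + 1) / a) * a \<le> b" by (rule assms) (use a in simp)
  then show False using a by simp
qed

text \<open>The strong convexity inequality along the segment from a minimizer z to z', written
  for the values a = F z, b = F z' and modulus term S, forces quadratic growth a + S \<le> b.\<close>
lemma growth_from_strong_convexity:
  fixes a b S :: real
  assumes min: "\<And>t. 0 < t \<Longrightarrow> t < 1 \<Longrightarrow> a \<le> t * b + (1 - t) * a - t * (1 - t) * S"
  shows "a + S \<le> b"
proof -
  have "u * S \<le> b - a" if "0 < u" "u < 1" for u
  proof -
    have "(1 - u) * (u * S) \<le> (1 - u) * (b - a)"
      using min[of "1 - u"] that by (simp add: algebra_simps)
    then show ?thesis using that by simp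
  qed
  then have "S \<le> b - a" by (rule field_le_mult_one_interval)
  then show ?thesis by simp
qed

text \<open>Sup on the reals is a fixed junk value on all sets that are unbounded above.\<close>
lemma Sup_unbounded_eq:
  fixes X Y :: "real set"
  assumes "\<not> bdd_above X" "\<not> bdd_above Y"
  shows "Sup X = Sup Y"
proof -
  have "(\<lambda>z. \<forall>x\<in>X. x \<le> z) = (\<lambda>z. \<forall>x\<in>Y. x \<le> z)"
    using assms unfolding bdd_above_def by (intro ext) blast
  then show ?thesis unfolding Sup_real_def by simp
qed

text \<open>A Q-linearly convergent nonnegative sequence, in the normalization of the theorem.\<close>
lemma linear_rate_powr:
  fixes e :: "nat \<Rightarrow> real" and \<rho> :: real
  assumes step: "\<And>k. e (Suc k) \<le> \<rho> * e k" and nonneg: "\<And>k. 0 \<le> e k"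
    and \<rho>: "0 < \<rho>" "\<rho> \<le> 1"
  shows "e (Suc k) \<le> \<rho> powr (real k - 1) * e 1"
proof -
  have pow: "e (Suc k) \<le> \<rho> ^ k * e 1"
  proof (induction k)
    case (Suc k)
    have "e (Suc (Suc k)) \<le> \<rho> * e (Suc k)" by (rule step)
    also have "\<dots> \<le> \<rho> * (\<rho> ^ k * e 1)" using Suc \<rho> by (intro mult_left_mono) auto
    finally show ?case by (simp add: mult.assoc)
  qed simp
  have "\<rho> ^ k \<le> \<rho> ^ k / \<rho>" using \<rho> by (simp add: field_simps)
  also have "\<dots> = \<rho> powr (real k - 1)" using \<rho> by (simp add: powr_diff powr_realpow)
  finally have "\<rho> ^ k * e 1 \<le> \<rho> powr (real k - 1) * e 1"
    using nonneg by (rule mult_right_mono)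
  with pow show ?thesis by linarith
qed
section \<open>Lagrangian duality for linearly constrained convex programs\<close>

lemma Lag_shift: "Lag f G g z m = Lag f G g z l + (m - l) \<bullet> (G *v z - g)"
  by (simp add: Lag_def inner_diff_left)

text \<open>Weak duality, pointwise: for a dual-feasible multiplier the Lagrangian underestimates
  the objective on the feasible set.\<close>
lemma Lag_le_objective:
  assumes "\<mu> \<in> dual_dom isEq" "feasible isEq G g z"
  shows "Lag f G g z \<mu> \<le> f z"
proof -
  have "\<mu>$r * (G *v z - g)$r \<le> 0" for r
    using assms unfolding feasible_def dual_dom_def
    by (cases "isEq r") (auto simp: mult_nonneg_nonpos dest: spec[where x=r])
  then have "\<mu> \<bullet> (G *v z - g) \<le> 0" unfolding inner_vec_def inner_real_def
    by (intro sum_nonpos) simp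
  then show ?thesis unfolding Lag_def by simp
qed

text \<open>The set of pairs (v, t) such that some z achieves objective value at most t, satisfies
  the equality rows with residual v and the inequality rows with residual at most v.  Its
  convexity is the heart of the Lagrangian duality argument.\<close>
definition value_set ::
  "(real^'n \<Rightarrow> real) \<Rightarrow> ('r \<Rightarrow> bool) \<Rightarrow> real^'n^'r \<Rightarrow> real^'r \<Rightarrow> ((real^'r) \<times> real) set" where
  "value_set f isEq G g = {(v, t). \<exists>z. f z \<le> t \<and> (\<forall>r. isEq r \<longrightarrow> v$r = (G *v z - g)$r)
                                       \<and> (\<forall>r. \<not> isEq r \<longrightarrow> (G *v z - g)$r \<le> v$r)}"

lemma value_set_convex:
  fixes G :: "real^'n^'r::finite"
  assumes "convex_on UNIV f"
  shows "convex (value_set f isEq G g)"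
proof (rule convexI)
  fix x y :: "(real^'r) \<times> real" and u w :: real
  assume x: "x \<in> value_set f isEq G g" and y: "y \<in> value_set f isEq G g"
    and u: "0 \<le> u" and w: "0 \<le> w" and uw: "u + w = 1"
  obtain v1 t1 z1 where x1: "x = (v1, t1)" "f z1 \<le> t1" "\<forall>r. isEq r \<longrightarrow> v1$r = (G *v z1 - g)$r"
    "\<forall>r. \<not> isEq r \<longrightarrow> (G *v z1 - g)$r \<le> v1$r" using x unfolding value_set_def by auto
  obtain v2 t2 z2 where y2: "y = (v2, t2)" "f z2 \<le> t2" "\<forall>r. isEq r \<longrightarrow> v2$r = (G *v z2 - g)$r"
    "\<forall>r. \<not> isEq r \<longrightarrow> (G *v z2 - g)$r \<le> v2$r" using y unfolding value_set_def by auto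
  define z where "z = u *\<^sub>R z1 + w *\<^sub>R z2"
  have "f z \<le> u * f z1 + w * f z2"
    using assms u w uw unfolding z_def convex_on_def by blast
  also have "\<dots> \<le> u * t1 + w * t2"
    using x1(2) y2(2) u w by (intro add_mono mult_left_mono)
  finally have fz: "f z \<le> u * t1 + w * t2" .
  have comp: "(G *v z - g)$r = u * (G *v z1 - g)$r + w * (G *v z2 - g)$r" for r
  proof -
    have "u * g$r + w * g$r = g$r" using uw by (metis distrib_right mult_1)
    then show ?thesis unfolding z_def
      by (simp add: matrix_vector_right_distrib matrix_vector_mult_scaleR algebra_simps)
  qed
  show "u *\<^sub>R x + w *\<^sub>R y \<in> value_set f isEq G g"
    unfolding value_set_def x1(1) y2(1)
    using x1(3,4) y2(3,4) comp u w fz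
    by (auto intro!: exI[where x=z] add_mono mult_left_mono)
qed

text \<open>The constraint qualification: a multiplier that has the sign of the inequality rows and
  keeps the constraint residuals bounded above must vanish, by Slater's condition and the full
  row rank of the equality block.\<close>
lemma slater_multiplier_zero:
  assumes rank: "full_row_rank_eq isEq G" and slater: "slater isEq G g"
    and sign: "\<And>r. \<not> isEq r \<Longrightarrow> a$r \<le> 0"
    and bounded: "\<And>z. a \<bullet> (G *v z - g) \<le> b" and b: "b \<le> 0"
  shows "a = 0"
proof -
  obtain z0 where z0: "\<forall>r. if isEq r then (G *v z0)$r = g$r else (G *v z0)$r < g$r"
    using slater unfolding slater_def by blast
  define v where "v = G *v z0 - g"
  have terms: "0 \<le> a$r * v$r" for r
    using z0 sign[of r] unfolding v_def
    by (cases "isEq r") (auto simp: mult_nonpos_nonpos dest: spec[where x=r])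
  have "(\<Sum>r\<in>UNIV. a$r * v$r) \<le> 0"
    using bounded[of z0] b unfolding v_def inner_vec_def by simp
  then have "(\<Sum>r\<in>UNIV. a$r * v$r) = 0"
    using terms by (simp add: order_antisym sum_nonneg)
  then have "\<forall>r\<in>UNIV. a$r * v$r = 0"
    using terms by (simp add: sum_nonneg_eq_0_iff)
  then have a_ineq: "a$r = 0" if "\<not> isEq r" for r
    using z0 that unfolding v_def by (force dest: spec[where x=r])
  define y where "y = transpose G *v a"
  have "(0 - (b + a \<bullet> g)) + s * (norm y)\<^sup>2 \<le> 0" if "0 \<le> s" for s
    using bounded[of "s *\<^sub>R y"] b dot_lmul_matrix[of a G y] unfolding y_def
    by (simp add: inner_diff_right power2_norm_eq_inner algebra_simps
        vector_transpose_matrix matrix_vector_mult_scaleR)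
  then have "(norm y)\<^sup>2 \<le> 0" by (rule bounded_ray_slope_nonpos)
  then have "transpose G *v a = 0" unfolding y_def by simp
  then show ?thesis using rank a_ineq unfolding full_row_rank_eq_def by blast
qed
text \<open>Strong duality under Slater's condition: a separating hyperplane between the value set
  and the open half-line below the optimal value yields a dual-feasible multiplier whose
  Lagrangian dominates the primal optimal value.\<close>
lemma slater_strong_duality:
  fixes f :: "real^'n \<Rightarrow> real" and G :: "real^'n^'r::finite"
  assumes convex: "convex_on UNIV f" and rank: "full_row_rank_eq isEq G"
    and slater: "slater isEq G g" and bdd: "bdd_below (f ` {z. feasible isEq G g z})"
  shows "\<exists>l\<in>dual_dom isEq. \<forall>z. primal_opt f isEq G g \<le> Lag f G g z l"
proof -
  define fs where "fs = primal_opt f isEq G g"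
  define S where "S = value_set f isEq G g"
  define T :: "((real^'r) \<times> real) set" where "T = {0} \<times> {..<fs}"
  have memS: "(G *v z - g + v, f z + s) \<in> S"
    if "\<And>r. isEq r \<Longrightarrow> v$r = 0" "\<And>r. 0 \<le> v$r" "0 \<le> s" for z v s
    using that unfolding S_def value_set_def by (auto intro!: exI[where x=z])
  have disjoint: "S \<inter> T = {}"
  proof (rule ccontr)
    assume "S \<inter> T \<noteq> {}"
    then obtain z where "feasible isEq G g z" "f z < fs"
      unfolding S_def T_def value_set_def feasible_def by fastforce
    moreover have "fs \<le> f z"
      unfolding fs_def primal_opt_def by (rule cInf_lower) (use bdd \<open>feasible isEq G g z\<close> in auto)
    ultimately show False by simp
  qed
  have "S \<noteq> {}" using memS[of 0 0 0] by auto
  moreover have "T \<noteq> {}" unfolding T_def by (auto intro: exI[of _ "fs - 1"])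
  moreover have "convex S" "convex T"
    unfolding S_def T_def using value_set_convex[OF convex] by (auto intro: convex_Times)
  ultimately obtain a b where ab: "a \<noteq> 0" "\<And>x. x \<in> S \<Longrightarrow> a \<bullet> x \<le> b" "\<And>x. x \<in> T \<Longrightarrow> b \<le> a \<bullet> x"
    using separating_hyperplane_sets[of S T] disjoint by blast
  obtain av \<beta> where a: "a = (av, \<beta>)" by (cases a)
  have S_below: "av \<bullet> (G *v z - g + v) + \<beta> * (f z + s) \<le> b"
    if "\<And>r. isEq r \<Longrightarrow> v$r = 0" "\<And>r. 0 \<le> v$r" "0 \<le> s" for z v s
    using ab(2)[OF memS[OF that]] a by simp
  have T_above: "b \<le> \<beta> * t" if "t < fs" for t
    using ab(3)[of "(0, t)"] that a unfolding T_def by simp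
  have \<beta>_nonpos: "\<beta> \<le> 0"
  proof (rule bounded_ray_slope_nonpos)
    fix s :: real assume "0 \<le> s"
    then show "(av \<bullet> (G *v 0 - g) + \<beta> * f 0) + s * \<beta> \<le> b"
      using S_below[of 0 s 0] by (simp add: algebra_simps)
  qed
  have av_sign: "av$r \<le> 0" if r: "\<not> isEq r" for r
  proof (rule bounded_ray_slope_nonpos)
    fix s :: real assume "0 \<le> s"
    have "av \<bullet> (G *v 0 - g + axis r s) + \<beta> * (f 0 + 0) \<le> b"
      by (rule S_below) (use r \<open>0 \<le> s\<close> in \<open>auto simp: axis_def\<close>)
    then show "(av \<bullet> (G *v 0 - g) + \<beta> * f 0) + s * av$r \<le> b"
      by (simp add: inner_add_right inner_axis algebra_simps)
  qed
  have "\<beta> \<noteq> 0"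
  proof
    assume \<beta>0: "\<beta> = 0"
    have "av = 0"
    proof (rule slater_multiplier_zero[OF rank slater av_sign])
      show "av \<bullet> (G *v z - g) \<le> b" for z using S_below[of 0 0 z] \<beta>0 by simp
      show "b \<le> 0" using T_above[of "fs - 1"] \<beta>0 by simp
    qed
    then show False using ab(1) a \<beta>0 by (simp add: zero_prod_def)
  qed
  with \<beta>_nonpos have \<beta>_neg: "\<beta> < 0" by simp
  define l where "l = (1 / \<beta>) *\<^sub>R av"
  have "l \<in> dual_dom isEq"
    unfolding dual_dom_def l_def using av_sign \<beta>_neg by (auto simp: divide_nonpos_neg)
  moreover have "fs \<le> Lag f G g z l" for z
  proof (rule dense_le)
    fix t assume "t < fs"
    then have "av \<bullet> (G *v z - g) + \<beta> * f z \<le> \<beta> * t"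
      using S_below[of 0 0 z] T_above by fastforce
    then have "\<beta> * Lag f G g z l \<le> \<beta> * t"
      unfolding Lag_def l_def using \<beta>_neg by (simp add: algebra_simps)
    then show "t \<le> Lag f G g z l" using \<beta>_neg by simp
  qed
  ultimately show ?thesis unfolding fs_def by blast
qed
section \<open>The projection onto the dual domain\<close>

lemma proj_D_mem: "proj_D isEq x \<in> dual_dom isEq"
  unfolding dual_dom_def proj_D_def by simp

text \<open>Variational inequality characterizing the projection onto the box D, coordinatewise.\<close>
lemma proj_D_variational:
  assumes "\<mu> \<in> dual_dom isEq"
  shows "(x$r - proj_D isEq x $r) * (\<mu>$r - proj_D isEq x $r) \<le> 0"
  using assms unfolding dual_dom_def proj_D_def
  by (cases "isEq r") (auto simp: max_def mult_nonpos_nonneg)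

section \<open>Block sparsity and the weights W\<close>

lemma blkproj_sum_sq:
  fixes blk :: "'n::finite \<Rightarrow> 'm::finite" and x :: "real^'n"
  shows "(\<Sum>i\<in>UNIV. (norm (blkproj blk i x))\<^sup>2) = (norm x)\<^sup>2"
proof -
  have "(\<Sum>i\<in>UNIV. (norm (blkproj blk i x))\<^sup>2)
      = (\<Sum>i\<in>(UNIV::'m set). \<Sum>c\<in>UNIV. if blk c = i then (x$c)\<^sup>2 else 0)"
    unfolding power2_norm_eq_inner
    by (rule sum.cong) (auto simp: inner_vec_def blkproj_def power2_eq_square intro!: sum.cong)
  also have "\<dots> = (\<Sum>c\<in>UNIV. (x$c)\<^sup>2)"
    by (subst sum.swap) simp
  also have "\<dots> = (norm x)\<^sup>2"
    unfolding power2_norm_eq_inner by (simp add: inner_vec_def power2_eq_square)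
  finally show ?thesis .
qed

text \<open>The part of G coupling the primal block i with the rows of the row blocks j where E j i
  holds, and the restriction of a dual vector to those rows.\<close>
definition block_submatrix ::
  "real^'n^'r \<Rightarrow> ('n \<Rightarrow> 'm) \<Rightarrow> ('r \<Rightarrow> 'mb) \<Rightarrow> ('mb \<Rightarrow> 'm \<Rightarrow> bool) \<Rightarrow> 'm \<Rightarrow> real^'n^'r" where
  "block_submatrix G blk rblk E i = (\<chi> r c. if E (rblk r) i \<and> blk c = i then G$r$c else 0)"

definition row_restrict :: "('r \<Rightarrow> 'mb) \<Rightarrow> ('mb \<Rightarrow> 'm \<Rightarrow> bool) \<Rightarrow> 'm \<Rightarrow> real^'r \<Rightarrow> real^'r" where
  "row_restrict rblk E i x = (\<chi> r. if E (rblk r) i then x$r else 0)"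

text \<open>By the sparsity pattern E, the bilinear form x^T G w splits into block contributions.\<close>
lemma coupling_split:
  fixes blk :: "'n::finite \<Rightarrow> 'm::finite" and G :: "real^'n^'r::finite"
  assumes sparsity: "\<And>r c. \<not> E (rblk r) (blk c) \<Longrightarrow> G$r$c = 0"
  shows "x \<bullet> (G *v w) = (\<Sum>i\<in>UNIV. row_restrict rblk E i x \<bullet>
                                     (block_submatrix G blk rblk E i *v blkproj blk i w))"
proof -
  have vanish: "(\<Sum>c\<in>UNIV. if blk c = i then x$r * G$r$c * w$c else 0) = 0"
    if "\<not> E (rblk r) i" for i r
    by (intro sum.neutral) (auto simp: sparsity that)
  have "(\<Sum>i\<in>UNIV. row_restrict rblk E i x \<bullet> (block_submatrix G blk rblk E i *v blkproj blk i w))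
     = (\<Sum>i\<in>UNIV. \<Sum>r\<in>UNIV. \<Sum>c\<in>UNIV. if blk c = i then x$r * G$r$c * w$c else 0)"
    unfolding inner_vec_def matrix_vector_mult_def blkproj_def row_restrict_def block_submatrix_def
    by (intro sum.cong refl) (auto simp: sum_distrib_left sparsity vanish intro!: sum.cong)
  also have "\<dots> = (\<Sum>r\<in>UNIV. \<Sum>c\<in>UNIV. \<Sum>i\<in>UNIV. if blk c = i then x$r * G$r$c * w$c else 0)"
    by (subst sum.swap) (intro sum.cong refl sum.swap)
  also have "\<dots> = x \<bullet> (G *v w)"
    unfolding inner_vec_def matrix_vector_mult_def by (simp add: sum_distrib_left mult.assoc)
  finally show ?thesis by simp
qed

text \<open>Young's inequality for a bilinear form given by a matrix M, with the constant
  expressed through the operator norm of M.\<close>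
lemma young_matrix:
  fixes M :: "real^'n::finite^'r::finite" and \<sigma> :: real
  assumes \<sigma>: "0 < \<sigma>"
  shows "- (\<sigma> / 2 * (norm v)\<^sup>2) - (onorm ((*v) M))\<^sup>2 / \<sigma> / 2 * (norm y)\<^sup>2 \<le> y \<bullet> (M *v v)"
proof -
  define a where "a = onorm ((*v) M) * norm y"
  define b where "b = norm v"
  have "\<bar>y \<bullet> (M *v v)\<bar> \<le> norm y * norm (M *v v)" by (rule Cauchy_Schwarz_ineq2)
  also have "\<dots> \<le> norm y * (onorm ((*v) M) * norm v)"
    by (intro mult_left_mono onorm) auto
  finally have ab: "- (a * b) \<le> y \<bullet> (M *v v)" unfolding a_def b_def by (simp add: algebra_simps)
  have "\<sigma> / 2 * b\<^sup>2 + a\<^sup>2 / (2 * \<sigma>) - a * b = (\<sigma> * b - a)\<^sup>2 / (2 * \<sigma>)"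
    using \<sigma> by (simp add: field_simps power2_eq_square)
  moreover have "0 \<le> (\<sigma> * b - a)\<^sup>2 / (2 * \<sigma>)" using \<sigma> by simp
  ultimately have "a * b \<le> \<sigma> / 2 * b\<^sup>2 + a\<^sup>2 / (2 * \<sigma>)" by linarith
  moreover have "a\<^sup>2 / (2 * \<sigma>) = (onorm ((*v) M))\<^sup>2 / \<sigma> / 2 * (norm y)\<^sup>2"
    unfolding a_def by (simp add: power_mult_distrib)
  ultimately show ?thesis using ab unfolding b_def by linarith
qed

text \<open>Summing the block constants L_{d_i} over the row restrictions produces exactly the
  diagonal weights W.\<close>
lemma row_restrict_weights:
  fixes G :: "real^'n::finite^'r::finite" and blk :: "'n \<Rightarrow> 'm::finite"
  shows "(\<Sum>i\<in>UNIV. Ld G blk rblk E \<sigma> i / 2 * (norm (row_restrict rblk E i x))\<^sup>2)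
       = 1/2 * (\<Sum>r\<in>UNIV. Wdiag G blk rblk E \<sigma> r * (x$r)\<^sup>2)"
proof -
  have "(\<Sum>i\<in>UNIV. Ld G blk rblk E \<sigma> i / 2 * (norm (row_restrict rblk E i x))\<^sup>2)
      = (\<Sum>i\<in>UNIV. \<Sum>r\<in>UNIV. (if E (rblk r) i then Ld G blk rblk E \<sigma> i else 0) * ((x$r)\<^sup>2 / 2))"
    unfolding power2_norm_eq_inner inner_vec_def row_restrict_def
    by (intro sum.cong refl) (auto simp: sum_distrib_left power2_eq_square intro!: sum.cong)
  also have "\<dots> = (\<Sum>r\<in>UNIV. (\<Sum>i\<in>UNIV. if E (rblk r) i then Ld G blk rblk E \<sigma> i else 0) * ((x$r)\<^sup>2 / 2))"
    by (subst sum.swap) (intro sum.cong refl sum_distrib_right[symmetric])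
  also have "\<dots> = 1/2 * (\<Sum>r\<in>UNIV. Wdiag G blk rblk E \<sigma> r * (x$r)\<^sup>2)"
    unfolding Wdiag_def by (simp add: sum.If_cases sum_distrib_left)
  finally show ?thesis .
qed

text \<open>The key estimate behind the W-smoothness of the dual function: the coupling x^T G w
  is bounded below by the strong convexity moduli on the primal side and by the W-norm on the
  dual side.\<close>
lemma coupling_bound:
  fixes blk :: "'n::finite \<Rightarrow> 'm::finite" and G :: "real^'n^'r::finite"
  assumes sparsity: "\<And>r c. \<not> E (rblk r) (blk c) \<Longrightarrow> G$r$c = 0"
    and sigma_pos: "\<And>i. 0 < \<sigma> i"
  shows "- (\<Sum>i\<in>UNIV. \<sigma> i / 2 * (norm (blkproj blk i w))\<^sup>2)
           - 1/2 * (\<Sum>r\<in>UNIV. Wdiag G blk rblk E \<sigma> r * (x$r)\<^sup>2) \<le> x \<bullet> (G *v w)"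
proof -
  have Ld: "Ld G blk rblk E \<sigma> i = (onorm ((*v) (block_submatrix G blk rblk E i)))\<^sup>2 / \<sigma> i" for i
    unfolding Ld_def block_submatrix_def ..
  have "(\<Sum>i\<in>UNIV. - (\<sigma> i / 2 * (norm (blkproj blk i w))\<^sup>2)
          - Ld G blk rblk E \<sigma> i / 2 * (norm (row_restrict rblk E i x))\<^sup>2)
      \<le> (\<Sum>i\<in>UNIV. row_restrict rblk E i x \<bullet> (block_submatrix G blk rblk E i *v blkproj blk i w))"
    unfolding Ld by (intro sum_mono young_matrix sigma_pos)
  also have "\<dots> = x \<bullet> (G *v w)" by (rule coupling_split[OF sparsity, symmetric])
  finally have "(\<Sum>i\<in>UNIV. - (\<sigma> i / 2 * (norm (blkproj blk i w))\<^sup>2)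
          - Ld G blk rblk E \<sigma> i / 2 * (norm (row_restrict rblk E i x))\<^sup>2) \<le> x \<bullet> (G *v w)" .
  then show ?thesis
    by (simp only: sum_subtractf sum_negf row_restrict_weights)
qed
section \<open>The dual gradient method\<close>

text \<open>The problem data of the paper together with an orbit (z^k, lambda^k) of the dual
  gradient method; the error bound enters only through the hypotheses of individual lemmas.\<close>
locale dual_gradient =
  fixes fi :: "'m::finite \<Rightarrow> real^'n \<Rightarrow> real"
    and \<sigma> :: "'m \<Rightarrow> real"
    and blk :: "'n \<Rightarrow> 'm"
    and rblk :: "'r::finite \<Rightarrow> 'mb::finite"
    and E :: "'mb \<Rightarrow> 'm \<Rightarrow> bool"
    and isEq :: "'r \<Rightarrow> bool"
    and G :: "real^'n^'r"
    and g :: "real^'r"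
    and zs :: "nat \<Rightarrow> real^'n"
    and lam :: "nat \<Rightarrow> real^'r"
    and f :: "real^'n \<Rightarrow> real"
    and Wd :: "'r \<Rightarrow> real"
    and \<Lambda>s :: "(real^'r) set"
  assumes f_def: "f = (\<lambda>z. \<Sum>i\<in>UNIV. fi i z)"
    and Wd_def: "Wd = Wdiag G blk rblk E \<sigma>"
    and \<Lambda>s_def: "\<Lambda>s = dual_opt_set f G g isEq"
    and E_sparsity: "\<And>j i r c. \<not> E j i \<Longrightarrow> rblk r = j \<Longrightarrow> blk c = i \<Longrightarrow> G$r$c = 0"
    and sigma_pos: "\<And>i. \<sigma> i > 0"
    and strongly_convex: "\<And>i. strongly_convex_blk blk i (\<sigma> i) (fi i)"
    and full_rank: "full_row_rank_eq isEq G"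
    and slater: "slater isEq G g"
    and W_pos: "\<And>r. Wd r > 0"
    and lam0: "lam 0 \<in> dual_dom isEq"
    and DG_z: "\<And>k z. Lag f G g (zs k) (lam k) \<le> Lag f G g z (lam k)"
    and DG_lam: "\<And>k. lam (Suc k) =
                   proj_D isEq (lam k + (\<chi> r. (G *v zs k - g)$r / Wd r))"
begin

abbreviation "Lg \<equiv> Lag f G g"
abbreviation "dual \<equiv> dualfun f G g"
abbreviation "fstar \<equiv> primal_opt f isEq G g"
abbreviation "D \<equiv> dual_dom isEq"

text \<open>The strong convexity modulus term of f between two points.\<close>
definition block_sq :: "real^'n \<Rightarrow> real^'n \<Rightarrow> real" where
  "block_sq z' z = (\<Sum>i\<in>UNIV. \<sigma> i / 2 * (norm (blkproj blk i (z' - z)))\<^sup>2)"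

definition \<sigma>min :: real where
  "\<sigma>min = Min (range \<sigma>)"

lemma \<sigma>min_pos: "0 < \<sigma>min"
  unfolding \<sigma>min_def using sigma_pos by (subst Min_gr_iff) auto

text \<open>The modulus term dominates a multiple of the squared Euclidean distance.\<close>
lemma block_sq_lower: "\<sigma>min / 2 * (norm (z' - z))\<^sup>2 \<le> block_sq z' z"
proof -
  have "\<sigma>min / 2 * (norm (z' - z))\<^sup>2
      = (\<Sum>i\<in>UNIV. \<sigma>min / 2 * (norm (blkproj blk i (z' - z)))\<^sup>2)"
    by (simp only: sum_distrib_left[symmetric] blkproj_sum_sq)
  also have "\<dots> \<le> block_sq z' z"
    unfolding block_sq_def \<sigma>min_def by (intro sum_mono mult_right_mono) auto
  finally show ?thesis .
qed

lemma f_strong: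
  assumes "0 \<le> t" "t \<le> 1"
  shows "f (t *\<^sub>R z' + (1-t) *\<^sub>R z) \<le> t * f z' + (1-t) * f z - t * (1-t) * block_sq z' z"
proof -
  have "f (t *\<^sub>R z' + (1-t) *\<^sub>R z) \<le> (\<Sum>i\<in>UNIV. t * fi i z' + (1-t) * fi i z
           - \<sigma> i / 2 * t * (1 - t) * (norm (blkproj blk i (z' - z)))\<^sup>2)"
    unfolding f_def using strongly_convex assms
    by (intro sum_mono) (auto simp: strongly_convex_blk_def)
  also have "\<dots> = t * f z' + (1-t) * f z - t * (1-t) * block_sq z' z"
    unfolding f_def block_sq_def
    by (simp add: sum.distrib sum_subtractf sum_distrib_left algebra_simps)
  finally show ?thesis .
qed

lemma f_convex: "convex_on UNIV f"
proof -
  have "f (u *\<^sub>R x + v *\<^sub>R y) \<le> u * f x + v * f y" if "0 \<le> u" "0 \<le> v" "u + v = 1" for x y u v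
  proof -
    have "0 \<le> block_sq x y"
      unfolding block_sq_def using sigma_pos by (intro sum_nonneg) (simp add: less_imp_le)
    then have "0 \<le> u * (1 - u) * block_sq x y" using that by simp
    moreover have "v = 1 - u" "u \<le> 1" using that by simp_all
    ultimately show ?thesis using f_strong[of u x y] that(1) by simp
  qed
  then show ?thesis unfolding convex_on_def by auto
qed

lemma Lag_strong:
  assumes "0 \<le> t" "t \<le> 1"
  shows "Lg (t *\<^sub>R z' + (1-t) *\<^sub>R z) l \<le> t * Lg z' l + (1-t) * Lg z l - t * (1-t) * block_sq z' z"
proof -
  have "l \<bullet> (G *v (t *\<^sub>R z' + (1-t) *\<^sub>R z) - g) = t * (l \<bullet> (G *v z' - g)) + (1-t) * (l \<bullet> (G *v z - g))"
    by (simp add: matrix_vector_right_distrib matrix_vector_mult_scaleR inner_add_right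
        inner_diff_right algebra_simps)
  then show ?thesis using f_strong[OF assms, of z' z] unfolding Lag_def by (simp add: algebra_simps)
qed

text \<open>Quadratic growth of the Lagrangian around a minimizer.\<close>
lemma Lag_growth:
  assumes min: "\<And>z''. Lg z l \<le> Lg z'' l"
  shows "Lg z l + block_sq z' z \<le> Lg z' l"
proof (rule growth_from_strong_convexity)
  fix t :: real assume "0 < t" "t < 1"
  then show "Lg z l \<le> t * Lg z' l + (1 - t) * Lg z l - t * (1 - t) * block_sq z' z"
    using min[of "t *\<^sub>R z' + (1-t) *\<^sub>R z"] Lag_strong[of t z' z l] by simp
qed

lemma argmin_unique:
  assumes "\<And>z''. Lg z1 l \<le> Lg z'' l" "\<And>z''. Lg z2 l \<le> Lg z'' l"
  shows "z1 = z2"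
proof -
  have "Lg z1 l + block_sq z2 z1 \<le> Lg z2 l" by (rule Lag_growth[OF assms(1)])
  then have "\<sigma>min / 2 * (norm (z2 - z1))\<^sup>2 \<le> 0"
    using assms(2)[of z1] block_sq_lower[of z2 z1] by simp
  then show ?thesis using \<sigma>min_pos by (simp add: mult_le_0_iff)
qed

text \<open>The iterate z^k is the minimizer z(lambda^k) used to define the dual gradient.\<close>
lemma zmin_iterate: "zmin f G g (lam k) = zs k"
  unfolding zmin_def by (rule the_equality) (use DG_z argmin_unique in blast)+

lemma dual_iterate: "dual (lam k) = Lg (zs k) (lam k)"
  unfolding dualfun_def by (rule cInf_eq_minimum) (use DG_z in auto)

text \<open>Every Lagrangian is bounded below: it differs from the Lagrangian at lambda^0, which
  grows quadratically, by a term of linear growth.\<close>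
lemma Lag_bdd_below: "bdd_below (range (\<lambda>z. Lg z \<mu>))"
proof -
  obtain K where K: "\<And>x. norm (G *v x) \<le> norm x * K"
    using bounded_linear.pos_bounded[OF matrix_vector_mul_bounded_linear[of G]] by blast
  define z0 where "z0 = zs 0"
  define a where "a = \<sigma>min / 2"
  define b where "b = norm (\<mu> - lam 0) * K"
  define c where "c = norm (\<mu> - lam 0) * norm (G *v z0 - g)"
  have a0: "a > 0" unfolding a_def using \<sigma>min_pos by simp
  have "Lg z0 (lam 0) - c - b\<^sup>2 / (4*a) \<le> Lg z \<mu>" for z
  proof -
    define u where "u = norm (z - z0)"
    have "Lg z0 (lam 0) + block_sq z z0 \<le> Lg z (lam 0)"
      by (rule Lag_growth) (use DG_z z0_def in auto)
    then have growth: "Lg z0 (lam 0) + a * u\<^sup>2 \<le> Lg z (lam 0)"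
      using block_sq_lower[of z z0] unfolding a_def u_def by simp
    have "norm (G *v z - g) = norm (G *v (z - z0) + (G *v z0 - g))"
      by (simp add: matrix_vector_mult_diff_distrib)
    also have "\<dots> \<le> norm (G *v (z - z0)) + norm (G *v z0 - g)" by (rule norm_triangle_ineq)
    also have "\<dots> \<le> u * K + norm (G *v z0 - g)" using K[of "z - z0"] unfolding u_def by simp
    finally have "\<bar>(\<mu> - lam 0) \<bullet> (G *v z - g)\<bar> \<le> norm (\<mu> - lam 0) * (u * K + norm (G *v z0 - g))"
      using Cauchy_Schwarz_ineq2[of "\<mu> - lam 0" "G *v z - g"]
      by (meson mult_left_mono norm_ge_zero order_trans)
    then have linear: "- (b * u + c) \<le> (\<mu> - lam 0) \<bullet> (G *v z - g)"
      unfolding b_def c_def by (simp add: algebra_simps)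
    have "a * u\<^sup>2 - b * u + b\<^sup>2 / (4*a) = a * (u - b / (2*a))\<^sup>2"
      using a0 by (simp add: field_simps power2_eq_square)
    then have "0 \<le> a * u\<^sup>2 - b * u + b\<^sup>2 / (4*a)" using a0 by simp
    then show ?thesis using Lag_shift[of f G g z \<mu> "lam 0"] growth linear by linarith
  qed
  then show ?thesis by (intro bdd_belowI2)
qed

lemma dual_le_Lag: "dual \<mu> \<le> Lg z \<mu>"
  unfolding dualfun_def by (rule cINF_lower[OF Lag_bdd_below]) simp

lemma dual_ge: "(\<And>z. c \<le> Lg z \<mu>) \<Longrightarrow> c \<le> dual \<mu>"
  unfolding dualfun_def by (rule cINF_greatest) auto

text \<open>W-smoothness of the Lagrangian in the multiplier, uniformly along minimizers: the
  descent-lemma form of the Lipschitz continuity of the dual gradient in the W-norm.\<close>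
lemma Lag_W_smooth:
  assumes min: "\<And>z''. Lg z l \<le> Lg z'' l"
  shows "Lg z l + (l' - l) \<bullet> (G *v z - g) - 1/2 * (\<Sum>r\<in>UNIV. Wd r * ((l' - l)$r)\<^sup>2) \<le> Lg z' l'"
proof -
  have "- block_sq z' z - 1/2 * (\<Sum>r\<in>UNIV. Wd r * ((l' - l)$r)\<^sup>2) \<le> (l' - l) \<bullet> (G *v (z' - z))"
    unfolding block_sq_def Wd_def using E_sparsity sigma_pos by (intro coupling_bound) blast+
  moreover have "(l' - l) \<bullet> (G *v z' - g) = (l' - l) \<bullet> (G *v z - g) + (l' - l) \<bullet> (G *v (z' - z))"
    by (simp add: matrix_vector_mult_diff_distrib inner_diff_right)
  ultimately show ?thesis using Lag_shift[of f G g z' l' l] Lag_growth[OF min, of z'] by linarith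
qed

lemma feasible_nonempty: "{z. feasible isEq G g z} \<noteq> {}"
proof -
  obtain z where "\<forall>r. if isEq r then (G *v z)$r = g$r else (G *v z)$r < g$r"
    using slater unfolding slater_def by blast
  then have "feasible isEq G g z" unfolding feasible_def by (metis less_imp_le)
  then show ?thesis by blast
qed

lemma weak_duality:
  assumes "\<mu> \<in> D"
  shows "dual \<mu> \<le> fstar"
  unfolding primal_opt_def
proof (rule cInf_greatest)
  show "f ` {z. feasible isEq G g z} \<noteq> {}" using feasible_nonempty by blast
  show "dual \<mu> \<le> y" if "y \<in> f ` {z. feasible isEq G g z}" for y
    using that dual_le_Lag Lag_le_objective[OF assms] by (fastforce intro: order_trans)
qed

lemma strong_duality: "\<exists>l\<in>D. \<forall>z. fstar \<le> Lg z l"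
proof (rule slater_strong_duality[OF f_convex full_rank slater])
  show "bdd_below (f ` {z. feasible isEq G g z})"
    using dual_le_Lag Lag_le_objective[OF lam0] by (intro bdd_belowI2) (blast intro: order_trans)
qed

text \<open>The dual optimal set consists of the dual-feasible multipliers whose Lagrangian
  dominates f^*; on it the dual function takes the value f^* (zero duality gap).\<close>
lemma dual_opt_char: "\<Lambda>s = {l\<in>D. \<forall>z. fstar \<le> Lg z l}"
proof -
  obtain ls where ls: "ls \<in> D" "\<And>z. fstar \<le> Lg z ls" using strong_duality by blast
  have dual_ls: "fstar \<le> dual ls" by (rule dual_ge) (rule ls(2))
  show ?thesis
    unfolding \<Lambda>s_def dual_opt_set_def
  proof (intro set_eqI iffI)
    fix l assume "l \<in> {l\<in>D. \<forall>\<mu>\<in>D. dual \<mu> \<le> dual l}"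
    then have "l \<in> D" "dual ls \<le> dual l" using ls(1) by auto
    then show "l \<in> {l\<in>D. \<forall>z. fstar \<le> Lg z l}"
      using dual_ls dual_le_Lag[of l] by (auto intro: order_trans)
  next
    fix l assume "l \<in> {l\<in>D. \<forall>z. fstar \<le> Lg z l}"
    then have "l \<in> D" "fstar \<le> dual l" using dual_ge by auto
    then show "l \<in> {l\<in>D. \<forall>\<mu>\<in>D. dual \<mu> \<le> dual l}"
      using weak_duality by (auto intro: order_trans)
  qed
qed

lemma dual_opt_value: "l \<in> \<Lambda>s \<Longrightarrow> dual l = fstar"
  unfolding dual_opt_char using weak_duality dual_ge by (auto intro: order_antisym)

lemma dual_opt_in_D: "l \<in> \<Lambda>s \<Longrightarrow> l \<in> D"
  unfolding dual_opt_char by simp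

lemma dual_opt_nonempty: "\<Lambda>s \<noteq> {}"
  unfolding dual_opt_char using strong_duality by blast

lemma dual_opt_closed: "closed \<Lambda>s"
proof -
  have "\<Lambda>s = (\<Inter>r\<in>{r. \<not> isEq r}. {l. 0 \<le> l$r}) \<inter> (\<Inter>z. {l. fstar \<le> f z + l \<bullet> (G *v z - g)})"
    unfolding dual_opt_char dual_dom_def Lag_def by auto
  also have "closed \<dots>"
    by (intro closed_Int closed_INT ballI closed_Collect_le continuous_intros)
  finally show ?thesis .
qed

abbreviation "scW \<equiv> wscale Wd"

lemma wnorm_eq: "wnorm Wd x = norm (scW x)"
  by (rule wnorm_wscale) (use W_pos in \<open>simp add: less_imp_le\<close>)

lemma wnorm_commute: "wnorm Wd (x - y) = wnorm Wd (y - x)"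
  unfolding wnorm_eq wscale_diff by (rule norm_minus_commute)

lemma norm_wscale_sq: "(norm (scW x))\<^sup>2 = (\<Sum>r\<in>UNIV. Wd r * (x$r)\<^sup>2)"
proof -
  have "0 \<le> (\<Sum>r\<in>UNIV. Wd r * (x$r)\<^sup>2)"
    using W_pos by (intro sum_nonneg) (simp add: less_imp_le)
  then show ?thesis unfolding wnorm_eq[symmetric] wnorm_def by simp
qed

text \<open>Lambda^* is closed and nonempty, so W-projections onto it exist.\<close>
lemma wproj_exists: "\<exists>y. y \<in> \<Lambda>s \<and> (\<forall>y'\<in>\<Lambda>s. wnorm Wd (l - y) \<le> wnorm Wd (l - y'))"
proof -
  have "closed (scW ` \<Lambda>s)"
    by (rule closed_injective_linear_image[OF dual_opt_closed linear_wscale inj_wscale]) (rule W_pos)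
  moreover have "scW ` \<Lambda>s \<noteq> {}" using dual_opt_nonempty by simp
  ultimately obtain x where x: "x \<in> scW ` \<Lambda>s"
      "\<And>y. y \<in> scW ` \<Lambda>s \<Longrightarrow> dist (scW l) x \<le> dist (scW l) y"
    using distance_attains_inf[of "scW ` \<Lambda>s" "scW l"] by auto
  then obtain y where y: "y \<in> \<Lambda>s" "x = scW y" by auto
  have "wnorm Wd (l - y) \<le> wnorm Wd (l - y')" if "y' \<in> \<Lambda>s" for y'
    using x(2)[of "scW y'"] that unfolding y(2) wnorm_eq dist_norm wscale_diff by simp
  with y(1) show ?thesis by blast
qed

lemma wproj_dual_opt:
  shows "wproj Wd \<Lambda>s l \<in> \<Lambda>s"
    and "\<And>y. y \<in> \<Lambda>s \<Longrightarrow> wnorm Wd (l - wproj Wd \<Lambda>s l) \<le> wnorm Wd (l - y)"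
  using someI_ex[OF wproj_exists[of l]] unfolding wproj_def by auto

lemma lam_in_D: "lam k \<in> D"
  by (cases k) (use lam0 DG_lam proj_D_mem in auto)

text \<open>The step lambda^{k+1} - lambda^k of the method.\<close>
definition step :: "nat \<Rightarrow> real^'r" where
  "step k = lam (Suc k) - lam k"

lemma prox_res_iterate: "prox_res f G g Wd isEq (lam k) = step k"
  unfolding prox_res_def dual_grad_def zmin_iterate step_def DG_lam ..

text \<open>The projection step in W-inner-product form: the dual gradient at lambda^k is
  dominated on D - lambda^{k+1} by the W-scaled step.\<close>
lemma projection_step:
  assumes "\<mu> \<in> D"
  shows "(G *v zs k - g) \<bullet> (\<mu> - lam (Suc k)) \<le> scW (step k) \<bullet> scW (\<mu> - lam (Suc k))"
proof -
  define x where "x = lam k + (\<chi> r. (G *v zs k - g)$r / Wd r)"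
  have "(G *v zs k - g)$r * (\<mu> - lam (Suc k))$r \<le> Wd r * (step k)$r * (\<mu> - lam (Suc k))$r" for r
  proof -
    have grad: "(G *v zs k - g)$r = Wd r * (x$r - lam k $r)"
      unfolding x_def using W_pos[of r] by simp
    have "Wd r * ((x$r - lam (Suc k) $r) * (\<mu>$r - lam (Suc k) $r)) \<le> 0"
      using proj_D_variational[OF assms, of x r] W_pos[of r]
      unfolding DG_lam x_def[symmetric] by (simp add: mult_nonneg_nonpos)
    then show ?thesis unfolding grad step_def by (simp add: algebra_simps)
  qed
  then have "(G *v zs k - g) \<bullet> (\<mu> - lam (Suc k)) \<le> (\<Sum>r\<in>UNIV. Wd r * (step k)$r * (\<mu> - lam (Suc k))$r)"
    unfolding inner_vec_def inner_real_def by (rule sum_mono)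
  then show ?thesis using inner_wscale[of Wd] W_pos by (simp add: less_imp_le)
qed

text \<open>The three-point inequality of the proximal gradient step on the W-smooth concave dual
  function, for any dual-feasible mu.\<close>
lemma three_point:
  assumes "\<mu> \<in> D"
  shows "dual \<mu> - dual (lam (Suc k))
           \<le> - (scW (lam k - \<mu>) \<bullet> scW (step k)) - 1/2 * (norm (scW (step k)))\<^sup>2"
proof -
  let ?grad = "G *v zs k - g"
  have upper: "dual \<mu> \<le> dual (lam k) + (\<mu> - lam k) \<bullet> ?grad"
    using dual_le_Lag[of \<mu> "zs k"] Lag_shift[of f G g "zs k" \<mu> "lam k"] dual_iterate[of k] by simp
  have lower: "dual (lam k) + step k \<bullet> ?grad - 1/2 * (norm (scW (step k)))\<^sup>2 \<le> dual (lam (Suc k))"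
    using Lag_W_smooth[of "zs k" "lam k" "lam (Suc k)" "zs (Suc k)"] DG_z dual_iterate
    unfolding step_def norm_wscale_sq by simp
  have "scW (\<mu> - lam (Suc k)) = - scW (lam k - \<mu>) - scW (step k)"
    unfolding step_def wscale_def by (simp add: vec_eq_iff algebra_simps)
  then have proj: "?grad \<bullet> (\<mu> - lam (Suc k))
                     \<le> - (scW (lam k - \<mu>) \<bullet> scW (step k)) - (norm (scW (step k)))\<^sup>2"
    using projection_step[OF assms, of k]
    by (simp add: inner_diff_right inner_minus_right inner_commute power2_norm_eq_inner)
  have "(\<mu> - lam k) \<bullet> ?grad - step k \<bullet> ?grad = ?grad \<bullet> (\<mu> - lam (Suc k))"
    unfolding step_def by (simp add: inner_diff_left inner_commute)
  with upper lower proj show ?thesis by linarith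
qed

text \<open>Each step increases the dual function by at least half the squared W-norm of the step.\<close>
lemma ascent: "1/2 * (norm (scW (step k)))\<^sup>2 \<le> dual (lam (Suc k)) - dual (lam k)"
  using three_point[OF lam_in_D[of k], of k] by (simp add: linear_0[OF linear_wscale])

text \<open>Fejer monotonicity: the W-distance to every dual optimal point is nonincreasing.\<close>
lemma fejer_step:
  assumes "\<mu> \<in> \<Lambda>s"
  shows "norm (scW (lam (Suc k) - \<mu>)) \<le> norm (scW (lam k - \<mu>))"
proof -
  have "0 \<le> dual \<mu> - dual (lam (Suc k))"
    using dual_opt_value[OF assms] weak_duality[OF lam_in_D] by simp
  also have "\<dots> \<le> - (scW (lam k - \<mu>) \<bullet> scW (step k)) - 1/2 * (norm (scW (step k)))\<^sup>2"
    by (rule three_point[OF dual_opt_in_D[OF assms]])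
  finally have decrease: "2 * (scW (lam k - \<mu>) \<bullet> scW (step k)) + (norm (scW (step k)))\<^sup>2 \<le> 0"
    by linarith
  have "scW (lam (Suc k) - \<mu>) = scW (lam k - \<mu>) + scW (step k)"
    unfolding step_def wscale_def by (simp add: vec_eq_iff algebra_simps)
  then have "(norm (scW (lam (Suc k) - \<mu>)))\<^sup>2
      = (norm (scW (lam k - \<mu>)))\<^sup>2 + (2 * (scW (lam k - \<mu>) \<bullet> scW (step k)) + (norm (scW (step k)))\<^sup>2)"
    by (simp add: power2_norm_eq_inner inner_add_left inner_add_right inner_commute)
  with decrease have "(norm (scW (lam (Suc k) - \<mu>)))\<^sup>2 \<le> (norm (scW (lam k - \<mu>)))\<^sup>2"
    by linarith
  then show ?thesis by (rule power2_le_imp_le) simp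
qed

lemma fejer:
  assumes "\<mu> \<in> \<Lambda>s"
  shows "wnorm Wd (lam k - \<mu>) \<le> wnorm Wd (lam 0 - \<mu>)"
proof (induction k)
  case (Suc k)
  then show ?case using fejer_step[OF assms, of k] unfolding wnorm_eq by linarith
qed simp

text \<open>Hence all iterates stay in the region where the error bound is assumed to hold.\<close>
lemma Tdist_iterate: "Tdist Wd \<Lambda>s (lam k) \<le> Tdist Wd \<Lambda>s (lam 0)"
proof (cases "bdd_above ((\<lambda>\<mu>. wnorm Wd (lam 0 - \<mu>)) ` \<Lambda>s)")
  case True
  show ?thesis unfolding Tdist_def
    by (rule cSUP_mono[OF dual_opt_nonempty True]) (use fejer in auto)
next
  case False
  have "\<not> bdd_above ((\<lambda>\<mu>. wnorm Wd (lam k - \<mu>)) ` \<Lambda>s)"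
  proof
    assume "bdd_above ((\<lambda>\<mu>. wnorm Wd (lam k - \<mu>)) ` \<Lambda>s)"
    then obtain M where M: "\<And>\<mu>. \<mu> \<in> \<Lambda>s \<Longrightarrow> wnorm Wd (lam k - \<mu>) \<le> M"
      unfolding bdd_above_def by auto
    have "wnorm Wd (lam 0 - \<mu>) \<le> wnorm Wd (lam 0 - lam k) + M" if "\<mu> \<in> \<Lambda>s" for \<mu>
      using norm_triangle_ineq[of "scW (lam 0 - lam k)" "scW (lam k - \<mu>)"] M[OF that]
      unfolding wnorm_eq wscale_diff by simp
    then have "bdd_above ((\<lambda>\<mu>. wnorm Wd (lam 0 - \<mu>)) ` \<Lambda>s)" by (intro bdd_aboveI2)
    with False show False by simp
  qed
  then show ?thesis unfolding Tdist_def using Sup_unbounded_eq[OF _ False] by simp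
qed

text \<open>The optimality gap of the dual iterates.\<close>
definition gap :: "nat \<Rightarrow> real" where
  "gap k = fstar - dual (lam k)"

lemma gap_nonneg: "0 \<le> gap k"
  unfolding gap_def using weak_duality[OF lam_in_D] by simp

text \<open>The gap after one step is bounded by the three-point inequality at the W-projection
  of lambda^k onto Lambda^*.\<close>
lemma gap_three_point:
  "gap (Suc k) \<le> - (scW (lam k - wproj Wd \<Lambda>s (lam k)) \<bullet> scW (step k))
                    - 1/2 * (norm (scW (step k)))\<^sup>2"
  using three_point[OF dual_opt_in_D[OF wproj_dual_opt(1)], of "lam k" k]
    dual_opt_value[OF wproj_dual_opt(1)] unfolding gap_def by simp

text \<open>Under the error bound the gap contracts Q-linearly with factor 2 kappa / (1 + 2 kappa).\<close>
lemma gap_contraction: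
  assumes \<kappa>: "0 < \<kappa>"
    and error_bound: "\<And>l. l \<in> D \<Longrightarrow> Tdist Wd \<Lambda>s l \<le> Tdist Wd \<Lambda>s (lam 0) \<Longrightarrow>
              wnorm Wd (l - wproj Wd \<Lambda>s l) \<le> \<kappa> * wnorm Wd (prox_res f G g Wd isEq l)"
  shows "gap (Suc k) \<le> 2 * \<kappa> / (1 + 2 * \<kappa>) * gap k"
proof -
  define p where "p = wproj Wd \<Lambda>s (lam k)"
  define s where "s = norm (scW (step k))"
  have eb: "norm (scW (lam k - p)) \<le> \<kappa> * s"
    using error_bound[OF lam_in_D Tdist_iterate]
    unfolding p_def s_def prox_res_iterate wnorm_eq .
  have "gap (Suc k) \<le> - (scW (lam k - p) \<bullet> scW (step k)) - 1/2 * s\<^sup>2"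
    unfolding p_def s_def by (rule gap_three_point)
  also have "\<dots> \<le> norm (scW (lam k - p)) * s"
    using Cauchy_Schwarz_ineq2[of "scW (lam k - p)" "scW (step k)"] zero_le_power2[of s]
      abs_ge_minus_self[of "scW (lam k - p) \<bullet> scW (step k)"] unfolding s_def by linarith
  also have "\<dots> \<le> \<kappa> * s\<^sup>2"
    using mult_right_mono[OF eb, of s] unfolding s_def by (simp add: power2_eq_square)
  also have "\<dots> \<le> \<kappa> * (2 * (gap k - gap (Suc k)))"
    using ascent[of k] \<kappa> unfolding gap_def s_def by (intro mult_left_mono) auto
  finally have "gap (Suc k) * (1 + 2 * \<kappa>) \<le> 2 * \<kappa> * gap k" by (simp add: algebra_simps)
  then show ?thesis using \<kappa> by (simp add: field_simps)
qed

text \<open>The first gap is bounded by half the squared W-distance from lambda^0 to Lambda^*.\<close>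
lemma gap_first: "gap 1 \<le> 1/2 * (Rdist Wd \<Lambda>s (lam 0))\<^sup>2"
proof -
  define p where "p = wproj Wd \<Lambda>s (lam 0)"
  have "Rdist Wd \<Lambda>s (lam 0) = norm (scW (lam 0 - p))"
    unfolding Rdist_def
  proof (rule cInf_eq_minimum)
    have "p \<in> \<Lambda>s" unfolding p_def by (rule wproj_dual_opt(1))
    moreover have "norm (scW (lam 0 - p)) = wnorm Wd (p - lam 0)"
      using wnorm_commute wnorm_eq by simp
    ultimately show "norm (scW (lam 0 - p)) \<in> (\<lambda>\<mu>. wnorm Wd (\<mu> - lam 0)) ` \<Lambda>s" by blast
    show "norm (scW (lam 0 - p)) \<le> x" if "x \<in> (\<lambda>\<mu>. wnorm Wd (\<mu> - lam 0)) ` \<Lambda>s" for x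
      using that wproj_dual_opt(2)[of _ "lam 0"] wnorm_commute unfolding p_def wnorm_eq by auto
  qed
  moreover have "0 \<le> (norm (scW (lam 0 - p) + scW (step 0)))\<^sup>2" by simp
  then have "- (scW (lam 0 - p) \<bullet> scW (step 0)) - 1/2 * (norm (scW (step 0)))\<^sup>2
              \<le> 1/2 * (norm (scW (lam 0 - p)))\<^sup>2"
    by (simp add: power2_norm_eq_inner inner_add_left inner_add_right inner_commute)
  ultimately show ?thesis using gap_three_point[of 0] unfolding p_def by simp
qed

end

theorem theorem2:
  fixes fi :: "'m::finite \<Rightarrow> real^'n \<Rightarrow> real"
    and \<sigma> L :: "'m \<Rightarrow> real"
    and blk :: "'n \<Rightarrow> 'm"
    and rblk :: "'r::finite \<Rightarrow> 'mb::finite"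
    and E :: "'mb \<Rightarrow> 'm \<Rightarrow> bool"
    and isEq :: "'r \<Rightarrow> bool"
    and G :: "real^'n^'r"
    and g :: "real^'r"
    and zs :: "nat \<Rightarrow> real^'n"
    and lam :: "nat \<Rightarrow> real^'r"
    and \<kappa> \<rho> :: real
    and f :: "real^'n \<Rightarrow> real"
    and Wd :: "'r \<Rightarrow> real"
    and \<Lambda>s :: "(real^'r) set"
  assumes f_def: "f = (\<lambda>z. \<Sum>i\<in>UNIV. fi i z)"
    and Wd_def: "Wd = Wdiag G blk rblk E \<sigma>"
    and \<Lambda>s_def: "\<Lambda>s = dual_opt_set f G g isEq"
    and \<rho>_def: "\<rho> = 4 * (1 + \<kappa>) / (1 + 4 * (1 + \<kappa>))"
    and E_sparsity: "\<And>j i r c. \<not> E j i \<Longrightarrow> rblk r = j \<Longrightarrow> blk c = i \<Longrightarrow> G$r$c = 0"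
    and separable: "\<And>i. depends_only_on_blk blk i (fi i)"
    and convex: "\<And>i. convex_on UNIV (fi i)"
    and sigma_pos: "\<And>i. \<sigma> i > 0"
    and strongly_convex: "\<And>i. strongly_convex_blk blk i (\<sigma> i) (fi i)"
    and lipschitz_grad: "\<And>i. lipschitz_grad_blk blk i (L i) (fi i)"
    and full_rank: "full_row_rank_eq isEq G"
    and slater: "slater isEq G g"
    and W_pos: "\<And>r. Wd r > 0"
    and lam0: "lam 0 \<in> dual_dom isEq"
    and DG_z: "\<And>k z. Lag f G g (zs k) (lam k) \<le> Lag f G g z (lam k)"
    and DG_lam: "\<And>k. lam (Suc k) =
                   proj_D isEq (lam k + (\<chi> r. (G *v zs k - g)$r / Wd r))"
    and kappa_pos: "\<kappa> > 0"
    and error_bound: "\<And>l. l \<in> dual_dom isEq \<Longrightarrow> Tdist Wd \<Lambda>s l \<le> Tdist Wd \<Lambda>s (lam 0) \<Longrightarrow>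
                wnorm Wd (l - wproj Wd \<Lambda>s l) \<le> \<kappa> * wnorm Wd (prox_res f G g Wd isEq l)"
  shows "\<forall>k. primal_opt f isEq G g - dualfun f G g (lam (Suc k))
              \<le> 1/2 * \<rho> powr (real k - 1) * (Rdist Wd \<Lambda>s (lam 0))\<^sup>2"
proof -
  interpret dual_gradient fi \<sigma> blk rblk E isEq G g zs lam f Wd \<Lambda>s
    by unfold_locales (fact f_def Wd_def \<Lambda>s_def E_sparsity sigma_pos strongly_convex
        full_rank slater W_pos lam0 DG_z DG_lam)+
  have \<rho>: "0 < \<rho>" "\<rho> \<le> 1" and factor: "2 * \<kappa> / (1 + 2 * \<kappa>) \<le> \<rho>"
    unfolding \<rho>_def using kappa_pos by (auto simp: field_simps)
  have contraction: "gap (Suc k) \<le> \<rho> * gap k" for k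
  proof -
    have "gap (Suc k) \<le> 2 * \<kappa> / (1 + 2 * \<kappa>) * gap k"
      using kappa_pos error_bound by (rule gap_contraction)
    also have "\<dots> \<le> \<rho> * gap k" using factor gap_nonneg by (rule mult_right_mono)
    finally show ?thesis .
  qed
  show ?thesis
  proof
    fix k
    have "gap (Suc k) \<le> \<rho> powr (real k - 1) * gap 1"
      using contraction gap_nonneg \<rho> by (rule linear_rate_powr)
    also have "\<dots> \<le> \<rho> powr (real k - 1) * (1/2 * (Rdist Wd \<Lambda>s (lam 0))\<^sup>2)"
      by (intro mult_left_mono gap_first) simp
    finally show "primal_opt f isEq G g - dualfun f G g (lam (Suc k))
        \<le> 1/2 * \<rho> powr (real k - 1) * (Rdist Wd \<Lambda>s (lam 0))\<^sup>2"
      unfolding gap_def by simp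
  qed
qed

end
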